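(* (Strong Normalisation for $\lambda LL$.) Every (well-typed) term $M$ of $\lambda LL$ is strongly normalizing: there is no infinite sequence of $\beta$-reduction steps $M=M_0\rightarrow M_1\rightarrow M_2\rightarrow\cdots$.
   Context: **Calculus $\lambda LL$.** Fix function symbols $\underline f$ with arities $n\ge 1$, each denoting a differentiable $f:\mathbb R^n\to\mathbb R$. Types: $A,B::=\mathbb R\mid A\multimap B\mid 1\mid A\otimes B\mid\top\mid A\& B\mid {!A}$. Each variable has a type fixed once and for all. Patterns: $p,q::=x\mid {!x}\mid ()\mid (p,q)\mid\langle p,q\rangle$, with no variable occurring twice; if $x$ has type $A$ then pattern $x$ has type $A$ and pattern $!x$ has type $!A$; $()$ has type $1$; $(p,q)$ has type $A\otimes B$ and $\langle p,q\rangle$ type $A\& B$ when $p:A$, $q:B$. Patterns $!x$ are called exponential. An environment is a finite set of typed patterns with pairwise disjoint variables; $!\Gamma$ denotes an environment all of whose patterns are exponential; the comma is union of environments having no variable in common. Terms (up to $\alpha$-equivalence): $M,N::=x\mid {!M}\mid\lambda p.M\mid MN\mid ()\mid (M,N)\mid\langle\rangle\mid\langle M,N\rangle\mid\underline r\ (r\in\mathbb R)\mid\underline f\mid\dot+\mid\dot*$. "Term" means well-typed term, i.e. a term $M$ with $\Gamma\vdash M:A$ derivable for some $\Gamma,A$. Typing rules: - $x:A\vdash x:A$; $\;!x:{!A}\vdash x:A$; - from $!\Gamma\vdash M:A$ infer $!\Gamma\vdash {!M}:{!A}$; from $\Delta\vdash M:B$ infer $!x:{!A},\Delta\vdash M:B$;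 - from $p:A,\Delta\vdash M:B$ infer $\Delta\vdash\lambda p.M:A\multimap B$; - from $!\Gamma_1,\Delta_1\vdash M:A\multimap B$ and $!\Gamma_2,\Delta_2\vdash N:A$ infer $!\Gamma_1\cup{!\Gamma_2},\Delta_1,\Delta_2\vdash MN:B$; - $\vdash ():1$; from $\Delta\vdash M:B$ infer $():1,\Delta\vdash M:B$; - from $!\Gamma_1,\Delta_1\vdash M:A$ and $!\Gamma_2,\Delta_2\vdash N:B$ infer $!\Gamma_1\cup{!\Gamma_2},\Delta_1,\Delta_2\vdash(M,N):A\otimes B$; from $p:A,q:B,\Delta\vdash M:C$ infer $(p,q):A\otimes B,\Delta\vdash M:C$; - from $\Delta\vdash M_1:A_1$ and $\Delta\vdash M_2:A_2$ infer $\Delta\vdash\langle M_1,M_2\rangle:A_1\& A_2$; for $i\in\{1,2\}$, from $p_i:A_i,\Delta\vdash M:B$ infer $\langle p_1,p_2\rangle:A_1\& A_2,\Delta\vdash M:B$; $\Delta\vdash\langle\rangle:\top$ for any $\Delta$; - $\vdash\underline r:\mathbb R$; $\Delta\vdash\underline 0:\mathbb R$ for any $\Delta$; $\vdash\underline f:({!\mathbb R}\otimes\dots\otimes{!\mathbb R})\multimap{!\mathbb R}$ ($n$ factors); $\vdash\dot+:(\mathbb R\&\mathbb R)\multimap\mathbb R$; $\vdash\dot*:\mathbb R\multimap\mathbb R\multimap\mathbb R$. **$\beta$-reduction.** Values for a pattern: any term of type $A$ is a value for a variable $x:A$; $()$ is the value for $()$; $!M$ (any $M$) is a value for $!x$;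 $(V_1,V_2)$ (resp. $\langle V_1,V_2\rangle$) is a value for $(p_1,p_2)$ (resp. $\langle p_1,p_2\rangle$) if each $V_i$ is a value for $p_i$. Substitution: $M\{V/x\}$ is capture-avoiding substitution, $M\{()/()\}=M$, $M\{!N/!x\}=M\{N/x\}$, $M\{(V_1,V_2)/(p_1,p_2)\}=M\{\langle V_1,V_2\rangle/\langle p_1,p_2\rangle\}=M\{V_1/p_1\}\{V_2/p_2\}$. The relation $\rightarrow$ is the closure under all one-hole term contexts of: $(\lambda p.M)V\rightarrow M\{V/p\}$ for $V$ a value for $p$; $\underline f(!\underline{r_1},\dots,!\underline{r_n})\rightarrow{!\underline{f(r_1,\dots,r_n)}}$; $\dot+\langle\underline{r_1},\underline{r_2}\rangle\rightarrow\underline{r_1+r_2}$; $\dot*\,\underline{r_1}\,\underline{r_2}\rightarrow\underline{r_1\cdot r_2}$. ($n$-fold $\otimes$ and pairs are right-nested.) *)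

theory Defs
  imports "HOL-Analysis.L2_Norm"
begin

(* Points of R^n are lists of length n, so that the dimension can depend on the function symbol. *)

definition vnorm :: "real list \<Rightarrow> real" where
  "vnorm h = L2_set (\<lambda>i. h ! i) {..<length h}"

(* Frechet differentiability at every point of R^n; lists of a length other than n are ignored. *)
definition differentiable_Rn :: "nat \<Rightarrow> (real list \<Rightarrow> real) \<Rightarrow> bool" where
  "differentiable_Rn n f \<longleftrightarrow>
     (\<forall>x. length x = n \<longrightarrow>
       (\<exists>a :: nat \<Rightarrow> real. \<forall>e>0. \<exists>d>0. \<forall>h. length h = n \<and> vnorm h < d \<longrightarrow>
          \<bar>f (map2 (+) x h) - f x - (\<Sum>i<n. a i * h ! i)\<bar> \<le> e * vnorm h))"

datatype ty =
    TReal
  | TLolli ty ty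
  | TOne
  | TTensor ty ty
  | TTop
  | TWith ty ty
  | TBang ty

(* A variable carries its type, with countably many names at each type. *)
datatype var = Var (vname: nat) (vty: ty)

(* Patterns proper are "var pat"; "ty pat" records the shape of a pattern and the types
   of its variables, which is what remains of it under a binder. *)
datatype 'a pat =
    PVar 'a
  | PBang 'a
  | PUnit
  | PTensor "'a pat" "'a pat"
  | PWith "'a pat" "'a pat"

primrec pvars :: "'a pat \<Rightarrow> 'a list" where
  "pvars (PVar x) = [x]"
| "pvars (PBang x) = [x]"
| "pvars PUnit = []"
| "pvars (PTensor p q) = pvars p @ pvars q"
| "pvars (PWith p q) = pvars p @ pvars q"

definition wf_pat :: "var pat \<Rightarrow> bool" where
  "wf_pat p \<longleftrightarrow> distinct (pvars p)"

primrec pty :: "var pat \<Rightarrow> ty" where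
  "pty (PVar x) = vty x"
| "pty (PBang x) = TBang (vty x)"
| "pty PUnit = TOne"
| "pty (PTensor p q) = TTensor (pty p) (pty q)"
| "pty (PWith p q) = TWith (pty p) (pty q)"

(* The type of a pattern is determined by its variables, so typed patterns are just patterns. *)
type_synonym env = "var pat set"

definition env_vars :: "env \<Rightarrow> var set" where
  "env_vars \<Gamma> = (\<Union>p\<in>\<Gamma>. set (pvars p))"

definition wf_env :: "env \<Rightarrow> bool" where
  "wf_env \<Gamma> \<longleftrightarrow> finite \<Gamma> \<and> (\<forall>p\<in>\<Gamma>. wf_pat p) \<and>
     (\<forall>p\<in>\<Gamma>. \<forall>q\<in>\<Gamma>. p \<noteq> q \<longrightarrow> set (pvars p) \<inter> set (pvars q) = {})"

definition exponential :: "env \<Rightarrow> bool" where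
  "exponential \<Gamma> \<longleftrightarrow> (\<forall>p\<in>\<Gamma>. \<exists>x. p = PBang x)"

definition apart :: "env \<Rightarrow> env \<Rightarrow> bool" where
  "apart \<Gamma> \<Delta> \<longleftrightarrow> env_vars \<Gamma> \<inter> env_vars \<Delta> = {}"

(* Terms up to alpha-equivalence, in locally nameless style: "Bound k i" is the i-th variable,
   from left to right, of the pattern of the k-th enclosing binder, counted from the inside.
   Binders are built only by lam below; the raw constructor Lam is auxiliary. *)
datatype 'f trm =
    Free var
  | Bound nat nat
  | Bang "'f trm"
  | Lam "ty pat" "'f trm"
  | App "'f trm" "'f trm"
  | Unit
  | Tensor "'f trm" "'f trm"
  | Top
  | With "'f trm" "'f trm"
  | Const real
  | Fun 'f
  | Add
  | Mul

primrec fv :: "'f trm \<Rightarrow> var set" where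
  "fv (Free x) = {x}"
| "fv (Bound k i) = {}"
| "fv (Bang M) = fv M"
| "fv (Lam s M) = fv M"
| "fv (App M N) = fv M \<union> fv N"
| "fv Unit = {}"
| "fv (Tensor M N) = fv M \<union> fv N"
| "fv Top = {}"
| "fv (With M N) = fv M \<union> fv N"
| "fv (Const r) = {}"
| "fv (Fun f) = {}"
| "fv Add = {}"
| "fv Mul = {}"

primrec close :: "nat \<Rightarrow> var list \<Rightarrow> 'f trm \<Rightarrow> 'f trm" where
  "close k xs (Free x) =
     (case map_of (zip xs [0..<length xs]) x of None \<Rightarrow> Free x | Some i \<Rightarrow> Bound k i)"
| "close k xs (Bound j i) = Bound j i"
| "close k xs (Bang M) = Bang (close k xs M)"
| "close k xs (Lam s M) = Lam s (close (Suc k) xs M)"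
| "close k xs (App M N) = App (close k xs M) (close k xs N)"
| "close k xs Unit = Unit"
| "close k xs (Tensor M N) = Tensor (close k xs M) (close k xs N)"
| "close k xs Top = Top"
| "close k xs (With M N) = With (close k xs M) (close k xs N)"
| "close k xs (Const r) = Const r"
| "close k xs (Fun f) = Fun f"
| "close k xs Add = Add"
| "close k xs Mul = Mul"

(* The abstraction of M over the named pattern p; equality of such terms is alpha-equivalence. *)
definition lam :: "var pat \<Rightarrow> 'f trm \<Rightarrow> 'f trm" where
  "lam p M = Lam (map_pat vty p) (close 0 (pvars p) M)"

(* The grammar of (not necessarily typable) terms. It excludes dangling indices. *)
inductive is_term :: "'f trm \<Rightarrow> bool" where
  "is_term (Free x)"
| "is_term M \<Longrightarrow> is_term (Bang M)"
| "wf_pat p \<Longrightarrow> is_term M \<Longrightarrow> is_term (lam p M)"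
| "is_term M \<Longrightarrow> is_term N \<Longrightarrow> is_term (App M N)"
| "is_term Unit"
| "is_term M \<Longrightarrow> is_term N \<Longrightarrow> is_term (Tensor M N)"
| "is_term Top"
| "is_term M \<Longrightarrow> is_term N \<Longrightarrow> is_term (With M N)"
| "is_term (Const r)"
| "is_term (Fun f)"
| "is_term Add"
| "is_term Mul"

(* Capture-avoiding when N is a term: bound variables have no names. *)
primrec subst :: "var \<Rightarrow> 'f trm \<Rightarrow> 'f trm \<Rightarrow> 'f trm" where
  "subst x N (Free y) = (if y = x then N else Free y)"
| "subst x N (Bound k i) = Bound k i"
| "subst x N (Bang M) = Bang (subst x N M)"
| "subst x N (Lam s M) = Lam s (subst x N M)"
| "subst x N (App M M') = App (subst x N M) (subst x N M')"
| "subst x N Unit = Unit"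
| "subst x N (Tensor M M') = Tensor (subst x N M) (subst x N M')"
| "subst x N Top = Top"
| "subst x N (With M M') = With (subst x N M) (subst x N M')"
| "subst x N (Const r) = Const r"
| "subst x N (Fun f) = Fun f"
| "subst x N Add = Add"
| "subst x N Mul = Mul"

(* Right-nested n-fold tensors; the value for the empty list (n = 0) is irrelevant. *)
fun tensor_ty :: "ty list \<Rightarrow> ty" where
  "tensor_ty [] = TOne"
| "tensor_ty [A] = A"
| "tensor_ty (A # B # As) = TTensor A (tensor_ty (B # As))"

fun tuple :: "'f trm list \<Rightarrow> 'f trm" where
  "tuple [] = Unit"
| "tuple [M] = M"
| "tuple (M # N # Ms) = Tensor M (tuple (N # Ms))"

(* In environments, the comma is insert or union together with the absence of shared variables. *)
inductive typing :: "('f \<Rightarrow> nat) \<Rightarrow> env \<Rightarrow> 'f trm \<Rightarrow> ty \<Rightarrow> bool" for ar where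
  var: "typing ar {PVar x} (Free x) (vty x)"
| bang_var: "typing ar {PBang x} (Free x) (vty x)"
| bang: "exponential \<Gamma> \<Longrightarrow> typing ar \<Gamma> M A \<Longrightarrow> typing ar \<Gamma> (Bang M) (TBang A)"
| weak: "typing ar \<Delta> M B \<Longrightarrow> apart {PBang x} \<Delta> \<Longrightarrow> typing ar (insert (PBang x) \<Delta>) M B"
| lam: "wf_pat p \<Longrightarrow> apart {p} \<Delta> \<Longrightarrow> typing ar (insert p \<Delta>) M B
        \<Longrightarrow> typing ar \<Delta> (lam p M) (TLolli (pty p) B)"
| app: "exponential \<Gamma>1 \<Longrightarrow> exponential \<Gamma>2
        \<Longrightarrow> apart (\<Gamma>1 \<union> \<Gamma>2) \<Delta>1 \<Longrightarrow> apart (\<Gamma>1 \<union> \<Gamma>2) \<Delta>2 \<Longrightarrow> apart \<Delta>1 \<Delta>2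
        \<Longrightarrow> typing ar (\<Gamma>1 \<union> \<Delta>1) M (TLolli A B) \<Longrightarrow> typing ar (\<Gamma>2 \<union> \<Delta>2) N A
        \<Longrightarrow> typing ar (\<Gamma>1 \<union> \<Gamma>2 \<union> \<Delta>1 \<union> \<Delta>2) (App M N) B"
| unit: "typing ar {} Unit TOne"
| unit_pat: "typing ar \<Delta> M B \<Longrightarrow> typing ar (insert PUnit \<Delta>) M B"
| tensor: "exponential \<Gamma>1 \<Longrightarrow> exponential \<Gamma>2
        \<Longrightarrow> apart (\<Gamma>1 \<union> \<Gamma>2) \<Delta>1 \<Longrightarrow> apart (\<Gamma>1 \<union> \<Gamma>2) \<Delta>2 \<Longrightarrow> apart \<Delta>1 \<Delta>2
        \<Longrightarrow> typing ar (\<Gamma>1 \<union> \<Delta>1) M A \<Longrightarrow> typing ar (\<Gamma>2 \<union> \<Delta>2) N B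
        \<Longrightarrow> typing ar (\<Gamma>1 \<union> \<Gamma>2 \<union> \<Delta>1 \<union> \<Delta>2) (Tensor M N) (TTensor A B)"
| tensor_pat: "apart {p} {q} \<Longrightarrow> apart {p, q} \<Delta> \<Longrightarrow> typing ar (insert p (insert q \<Delta>)) M C
        \<Longrightarrow> typing ar (insert (PTensor p q) \<Delta>) M C"
| "with": "typing ar \<Delta> M1 A1 \<Longrightarrow> typing ar \<Delta> M2 A2 \<Longrightarrow> typing ar \<Delta> (With M1 M2) (TWith A1 A2)"
| with_pat1: "wf_pat p2 \<Longrightarrow> apart {p1} {p2} \<Longrightarrow> apart {p1, p2} \<Delta> \<Longrightarrow> typing ar (insert p1 \<Delta>) M B
        \<Longrightarrow> typing ar (insert (PWith p1 p2) \<Delta>) M B"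
| with_pat2: "wf_pat p1 \<Longrightarrow> apart {p1} {p2} \<Longrightarrow> apart {p1, p2} \<Delta> \<Longrightarrow> typing ar (insert p2 \<Delta>) M B
        \<Longrightarrow> typing ar (insert (PWith p1 p2) \<Delta>) M B"
| top: "wf_env \<Delta> \<Longrightarrow> typing ar \<Delta> Top TTop"
| const: "typing ar {} (Const r) TReal"
| zero: "wf_env \<Delta> \<Longrightarrow> typing ar \<Delta> (Const 0) TReal"
| "fun": "typing ar {} (Fun f) (TLolli (tensor_ty (replicate (ar f) (TBang TReal))) (TBang TReal))"
| add: "typing ar {} Add (TLolli (TWith TReal TReal) TReal)"
| mul: "typing ar {} Mul (TLolli TReal (TLolli TReal TReal))"

definition well_typed :: "('f \<Rightarrow> nat) \<Rightarrow> 'f trm \<Rightarrow> bool" where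
  "well_typed ar M \<longleftrightarrow> (\<exists>\<Gamma> A. typing ar \<Gamma> M A)"

inductive is_value :: "('f \<Rightarrow> nat) \<Rightarrow> var pat \<Rightarrow> 'f trm \<Rightarrow> bool" for ar where
  "typing ar \<Gamma> M (vty x) \<Longrightarrow> is_value ar (PVar x) M"
| "is_value ar PUnit Unit"
| "is_value ar (PBang x) (Bang M)"
| "is_value ar p1 V1 \<Longrightarrow> is_value ar p2 V2 \<Longrightarrow> is_value ar (PTensor p1 p2) (Tensor V1 V2)"
| "is_value ar p1 V1 \<Longrightarrow> is_value ar p2 V2 \<Longrightarrow> is_value ar (PWith p1 p2) (With V1 V2)"

(* "psubst p V M" is M{V/p}; the last equation only covers V that are not values for p. *)
fun psubst :: "var pat \<Rightarrow> 'f trm \<Rightarrow> 'f trm \<Rightarrow> 'f trm" where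
  "psubst (PVar x) V M = subst x V M"
| "psubst PUnit Unit M = M"
| "psubst (PBang x) (Bang N) M = subst x N M"
| "psubst (PTensor p1 p2) (Tensor V1 V2) M = psubst p2 V2 (psubst p1 V1 M)"
| "psubst (PWith p1 p2) (With V1 V2) M = psubst p2 V2 (psubst p1 V1 M)"
| "psubst _ _ M = M"

(* In the rule beta the bound variables are chosen not to occur in V, as always possible up to
   alpha-equivalence: M{V1/p1}{V2/p2} is meaningful only if no variable of p2 occurs in V1.
   The is_term premises exclude dangling indices, which abstraction could otherwise capture. *)
inductive red :: "('f \<Rightarrow> nat) \<Rightarrow> ('f \<Rightarrow> real list \<Rightarrow> real) \<Rightarrow> 'f trm \<Rightarrow> 'f trm \<Rightarrow> bool" for ar den where
  beta: "wf_pat p \<Longrightarrow> is_term M \<Longrightarrow> is_term V \<Longrightarrow> is_value ar p V \<Longrightarrow> set (pvars p) \<inter> fv V = {}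
        \<Longrightarrow> red ar den (App (lam p M) V) (psubst p V M)"
| "fun": "length rs = ar f
        \<Longrightarrow> red ar den (App (Fun f) (tuple (map (\<lambda>r. Bang (Const r)) rs))) (Bang (Const (den f rs)))"
| add: "red ar den (App Add (With (Const r1) (Const r2))) (Const (r1 + r2))"
| mul: "red ar den (App (App Mul (Const r1)) (Const r2)) (Const (r1 * r2))"
| bang: "red ar den M M' \<Longrightarrow> red ar den (Bang M) (Bang M')"
| lam: "wf_pat p \<Longrightarrow> is_term M \<Longrightarrow> red ar den M M' \<Longrightarrow> red ar den (lam p M) (lam p M')"
| app1: "red ar den M M' \<Longrightarrow> red ar den (App M N) (App M' N)"
| app2: "red ar den N N' \<Longrightarrow> red ar den (App M N) (App M N')"
| tensor1: "red ar den M M' \<Longrightarrow> red ar den (Tensor M N) (Tensor M' N)"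
| tensor2: "red ar den N N' \<Longrightarrow> red ar den (Tensor M N) (Tensor M N')"
| with1: "red ar den M M' \<Longrightarrow> red ar den (With M N) (With M' N)"
| with2: "red ar den N N' \<Longrightarrow> red ar den (With M N) (With M N')"

definition strongly_normalizing :: "('f \<Rightarrow> nat) \<Rightarrow> ('f \<Rightarrow> real list \<Rightarrow> real) \<Rightarrow> 'f trm \<Rightarrow> bool" where
  "strongly_normalizing ar den M \<longleftrightarrow>
     \<not> (\<exists>S :: nat \<Rightarrow> 'f trm. S 0 = M \<and> (\<forall>i. red ar den (S i) (S (Suc i))))"

end

theory Submission
  imports Defs
begin

text \<open>
  Linearity plays no role for termination. Since every variable carries its type, the environment
  of a typing derivation can be forgotten altogether, which leaves a simply typed
  \<open>\<lambda>\<close>-calculus with pattern matching. Reduction is embedded into a more liberal relation on raw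
  de Bruijn terms, which is stable under simultaneous substitution without any side condition, and
  strong normalisation of the latter is proved with Girard's reducibility sets. For the positive
  types, a term is reducible if it is strongly normalising and every value it reduces to has
  reducible components; hence terms on which a match is stuck need no special treatment.
\<close>

section \<open>Simultaneous substitution\<close>

text \<open>Only binder levels are renamed. The shift \<open>lift\<close> has to exist before
  \<open>sub\<close>, whose recursion under a binder uses it.\<close>

primrec ren :: "(nat \<Rightarrow> nat) \<Rightarrow> 'f trm \<Rightarrow> 'f trm" where
  "ren r (Free x) = Free x"
| "ren r (Bound k i) = Bound (r k) i"
| "ren r (Bang M) = Bang (ren r M)"
| "ren r (Lam s M) = Lam s (ren (case_nat 0 (\<lambda>k. Suc (r k))) M)"
| "ren r (App M N) = App (ren r M) (ren r N)"
| "ren r Unit = Unit"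
| "ren r (Tensor M N) = Tensor (ren r M) (ren r N)"
| "ren r Top = Top"
| "ren r (With M N) = With (ren r M) (ren r N)"
| "ren r (Const c) = Const c"
| "ren r (Fun f) = Fun f"
| "ren r Add = Add"
| "ren r Mul = Mul"

abbreviation lift :: "'f trm \<Rightarrow> 'f trm" where
  "lift \<equiv> ren Suc"

definition ups :: "(nat \<Rightarrow> nat \<Rightarrow> 'f trm) \<Rightarrow> nat \<Rightarrow> nat \<Rightarrow> 'f trm" where
  "ups \<sigma> = case_nat (Bound 0) (\<lambda>k i. lift (\<sigma> k i))"

lemma ups_simps [simp]:
  "ups \<sigma> 0 = Bound 0" "ups \<sigma> (Suc k) = (\<lambda>i. lift (\<sigma> k i))"
  by (simp_all add: ups_def)

text \<open>Both kinds of images are lifted under a binder, so they may contain dangling indices and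
  the composition laws hold for all raw terms.\<close>

primrec sub :: "(var \<Rightarrow> 'f trm) \<Rightarrow> (nat \<Rightarrow> nat \<Rightarrow> 'f trm) \<Rightarrow> 'f trm \<Rightarrow> 'f trm" where
  "sub \<phi> \<sigma> (Free x) = \<phi> x"
| "sub \<phi> \<sigma> (Bound k i) = \<sigma> k i"
| "sub \<phi> \<sigma> (Bang M) = Bang (sub \<phi> \<sigma> M)"
| "sub \<phi> \<sigma> (Lam s M) = Lam s (sub (\<lambda>x. lift (\<phi> x)) (ups \<sigma>) M)"
| "sub \<phi> \<sigma> (App M N) = App (sub \<phi> \<sigma> M) (sub \<phi> \<sigma> N)"
| "sub \<phi> \<sigma> Unit = Unit"
| "sub \<phi> \<sigma> (Tensor M N) = Tensor (sub \<phi> \<sigma> M) (sub \<phi> \<sigma> N)"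
| "sub \<phi> \<sigma> Top = Top"
| "sub \<phi> \<sigma> (With M N) = With (sub \<phi> \<sigma> M) (sub \<phi> \<sigma> N)"
| "sub \<phi> \<sigma> (Const c) = Const c"
| "sub \<phi> \<sigma> (Fun f) = Fun f"
| "sub \<phi> \<sigma> Add = Add"
| "sub \<phi> \<sigma> Mul = Mul"

lemma ren_ren: "ren r (ren r' M) = ren (\<lambda>k. r (r' k)) M"
proof (induction M arbitrary: r r')
  case (Lam s M)
  have "(\<lambda>k. case_nat 0 (\<lambda>k. Suc (r k)) (case_nat 0 (\<lambda>k. Suc (r' k)) k))
      = case_nat 0 (\<lambda>k. Suc (r (r' k)))"
    by (auto simp: fun_eq_iff split: nat.split)
  with Lam show ?case by simp
qed simp_all

lemma sub_ren: "sub \<phi> \<sigma> (ren r M) = sub \<phi> (\<lambda>k. \<sigma> (r k)) M"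
proof (induction M arbitrary: \<phi> \<sigma> r)
  case (Lam s M)
  have "(\<lambda>k. ups \<sigma> (case_nat 0 (\<lambda>k. Suc (r k)) k)) = ups (\<lambda>k. \<sigma> (r k))"
    by (auto simp: fun_eq_iff split: nat.split)
  with Lam show ?case by simp
qed simp_all

lemma ren_sub: "ren r (sub \<phi> \<sigma> M) = sub (\<lambda>x. ren r (\<phi> x)) (\<lambda>k i. ren r (\<sigma> k i)) M"
proof (induction M arbitrary: \<phi> \<sigma> r)
  case (Lam s M)
  have "(\<lambda>k i. ren (case_nat 0 (\<lambda>k. Suc (r k))) (ups \<sigma> k i)) = ups (\<lambda>k i. ren r (\<sigma> k i))"
    by (auto simp: fun_eq_iff ups_def ren_ren split: nat.split)
  with Lam show ?case by (simp add: ren_ren)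
qed simp_all

text \<open>Under a binder the shift must pass through both substitutions; \<open>sub_ren\<close>
  and \<open>ren_sub\<close> provide this and therefore come first.\<close>

lemma sub_sub:
  "sub \<phi> \<sigma> (sub \<phi>' \<sigma>' M) = sub (\<lambda>x. sub \<phi> \<sigma> (\<phi>' x)) (\<lambda>k i. sub \<phi> \<sigma> (\<sigma>' k i)) M"
proof (induction M arbitrary: \<phi> \<sigma> \<phi>' \<sigma>')
  case (Lam s M)
  have "(\<lambda>k i. sub (\<lambda>x. lift (\<phi> x)) (ups \<sigma>) (ups \<sigma>' k i)) = ups (\<lambda>k i. sub \<phi> \<sigma> (\<sigma>' k i))"
    by (auto simp: fun_eq_iff ups_def sub_ren ren_sub split: nat.split)
  with Lam show ?case by (simp add: sub_ren ren_sub)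
qed simp_all

lemma ups_Bound [simp]: "ups Bound = Bound"
  by (auto simp: fun_eq_iff ups_def split: nat.split)

lemma sub_id [simp]: "sub Free Bound M = M"
  by (induction M) simp_all

text \<open>The default \<open>Unit\<close> for a missing component is closed, so that \<open>sub_inst\<close> holds without any
  condition on the length of the list.\<close>

definition inst :: "'f trm list \<Rightarrow> nat \<Rightarrow> nat \<Rightarrow> 'f trm" where
  "inst vs = case_nat (\<lambda>i. if i < length vs then vs ! i else Unit) Bound"

lemma inst_simps [simp]:
  "inst vs 0 i = (if i < length vs then vs ! i else Unit)" "inst vs (Suc k) = Bound k"
  by (simp_all add: inst_def)

text \<open>Instantiation cancels the shift made by \<open>lift\<close>, so the two passes merge
  into one with \<open>vs\<close> as the innermost level.\<close>

lemma sub_inst_ups: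
  "sub Free (inst vs) (sub (\<lambda>x. lift (\<phi> x)) (ups \<sigma>) M)
     = sub \<phi> (case_nat (inst vs 0) \<sigma>) M"
proof -
  have "(\<lambda>k i. sub Free (inst vs) (ups \<sigma> k i)) = case_nat (inst vs 0) \<sigma>"
    by (auto simp: fun_eq_iff ups_def sub_ren split: nat.split)
  then show ?thesis by (simp add: sub_sub sub_ren)
qed

text \<open>Both sides collapse to the same single substitution. This is the beta case of
  \<open>step_sub\<close>.\<close>

lemma sub_inst:
  "sub \<phi> \<sigma> (sub Free (inst vs) M)
     = sub Free (inst (map (sub \<phi> \<sigma>) vs)) (sub (\<lambda>x. lift (\<phi> x)) (ups \<sigma>) M)"
proof -
  have "(\<lambda>k i. sub \<phi> \<sigma> (inst vs k i)) = case_nat (inst (map (sub \<phi> \<sigma>) vs) 0) \<sigma>"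
    by (auto simp: fun_eq_iff inst_def split: nat.split)
  then show ?thesis unfolding sub_inst_ups by (simp add: sub_sub)
qed

section \<open>A liberal reduction on raw terms\<close>

text \<open>Polymorphic in the labels, so that it serves both named patterns and the type-labelled
  shapes under \<open>Lam\<close>.\<close>

inductive matches :: "'a pat \<Rightarrow> 'f trm \<Rightarrow> 'f trm list \<Rightarrow> bool" where
  "matches (PVar a) V [V]"
| "matches (PBang a) (Bang N) [N]"
| "matches PUnit Unit []"
| "matches p V vs \<Longrightarrow> matches q W ws \<Longrightarrow> matches (PTensor p q) (Tensor V W) (vs @ ws)"
| "matches p V vs \<Longrightarrow> matches q W ws \<Longrightarrow> matches (PWith p q) (With V W) (vs @ ws)"

text \<open>The primitives may rewrite to arbitrary constants, whatever their arguments: this keeps the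
  relation independent of the interpretation of the function symbols.\<close>

inductive step :: "'f trm \<Rightarrow> 'f trm \<Rightarrow> bool" where
  beta: "matches s V vs \<Longrightarrow> step (App (Lam s M) V) (sub Free (inst vs) M)"
| "fun": "step (App (Fun f) N) (Bang (Const r))"
| add: "step (App Add N) (Const r)"
| mul: "step (App (App Mul N) P) (Const r)"
| bang: "step M M' \<Longrightarrow> step (Bang M) (Bang M')"
| lam: "step M M' \<Longrightarrow> step (Lam s M) (Lam s M')"
| app1: "step M M' \<Longrightarrow> step (App M N) (App M' N)"
| app2: "step N N' \<Longrightarrow> step (App M N) (App M N')"
| tensor1: "step M M' \<Longrightarrow> step (Tensor M N) (Tensor M' N)"
| tensor2: "step N N' \<Longrightarrow> step (Tensor M N) (Tensor M N')"
| with1: "step M M' \<Longrightarrow> step (With M N) (With M' N)"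
| with2: "step N N' \<Longrightarrow> step (With M N) (With M N')"

inductive_cases step_AppE: "step (App M N) L"
inductive_cases step_LamE: "step (Lam s M) L"
inductive_cases step_BangE: "step (Bang M) L"
inductive_cases step_TensorE: "step (Tensor M N) L"
inductive_cases step_WithE: "step (With M N) L"

lemma step_irreducible [simp]:
  "\<not> step (Free x) L" "\<not> step Unit L" "\<not> step Top L" "\<not> step (Const r) L"
  "\<not> step (Fun f) L" "\<not> step Add L" "\<not> step Mul L"
  by (auto elim: step.cases)

lemma matches_sub: "matches p V vs \<Longrightarrow> matches p (sub \<phi> \<sigma> V) (map (sub \<phi> \<sigma>) vs)"
  by (induction rule: matches.induct) (auto intro: matches.intros)

lemma step_sub: "step M M' \<Longrightarrow> step (sub \<phi> \<sigma> M) (sub \<phi> \<sigma> M')"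
proof (induction arbitrary: \<phi> \<sigma> rule: step.induct)
  case (beta s V vs M)
  then show ?case
    by (simp add: sub_inst step.beta matches_sub)
qed (auto intro: step.intros)

section \<open>Strong normalisation as accessibility\<close>

inductive SN :: "'f trm \<Rightarrow> bool" where
  SNI: "(\<And>M'. step M M' \<Longrightarrow> SN M') \<Longrightarrow> SN M"

lemma SN_step: "SN M \<Longrightarrow> step M M' \<Longrightarrow> SN M'"
  by (auto elim: SN.cases)

text \<open>An infinite reduction from \<open>M\<close> would be mapped by \<open>f\<close> to one
  from \<open>f M\<close>. It is applied with \<open>f\<close> an application to a fixed argument or
  a substitution.\<close>

lemma SN_inj:
  assumes "SN (f M)" and f: "\<And>M M'. step M M' \<Longrightarrow> step (f M) (f M')"
  shows "SN M"
  using assms(1)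
proof (induction "f M" arbitrary: M rule: SN.induct)
  case SNI
  then show ?case by (blast intro: SN.SNI f)
qed

lemma SN_Bang: "SN M \<Longrightarrow> SN (Bang M)"
  by (induction rule: SN.induct) (rule SNI, auto elim: step_BangE)

text \<open>Nested accessibility inductions; the outer hypothesis ranges over all strongly
  normalising \<open>N\<close>.\<close>

lemma SN_induct2 [consumes 2, case_names step]:
  assumes "SN M" and "SN N"
    and "\<And>M N. SN M \<Longrightarrow> SN N \<Longrightarrow> (\<And>M'. step M M' \<Longrightarrow> P M' N) \<Longrightarrow> (\<And>N'. step N N' \<Longrightarrow> P M N')
      \<Longrightarrow> P M N"
  shows "P M N"
  using assms(1,2)
proof (induction M arbitrary: N rule: SN.induct)
  case (SNI M)
  note outer = SNI
  from \<open>SN N\<close> show ?case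
  proof (induction N rule: SN.induct)
    case (SNI N)
    have "SN M" "SN N" using outer(1) SNI(1) by (blast intro: SN.SNI)+
    then show ?case
    proof (rule assms(3))
      show "P M' N" if "step M M'" for M' using outer(2)[OF that] \<open>SN N\<close> .
      show "P M N'" if "step N N'" for N' using SNI(2)[OF that] .
    qed
  qed
qed

lemma SN_Tensor: "SN M \<Longrightarrow> SN N \<Longrightarrow> SN (Tensor M N)"
  by (induction rule: SN_induct2) (rule SNI, auto elim: step_TensorE)

lemma SN_With: "SN M \<Longrightarrow> SN N \<Longrightarrow> SN (With M N)"
  by (induction rule: SN_induct2) (rule SNI, auto elim: step_WithE)

section \<open>Reducibility\<close>

primrec redu :: "ty \<Rightarrow> 'f trm set" where
  "redu TReal = {M. SN M}"
| "redu (TLolli A B) = {M. \<forall>N\<in>redu A. App M N \<in> redu B}"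
| "redu TOne = {M. SN M}"
| "redu (TTensor A B) =
     {M. SN M \<and> (\<forall>N P. step\<^sup>*\<^sup>* M (Tensor N P) \<longrightarrow> N \<in> redu A \<and> P \<in> redu B)}"
| "redu TTop = {M. SN M}"
| "redu (TWith A B) =
     {M. SN M \<and> (\<forall>N P. step\<^sup>*\<^sup>* M (With N P) \<longrightarrow> N \<in> redu A \<and> P \<in> redu B)}"
| "redu (TBang A) = {M. SN M \<and> (\<forall>N. step\<^sup>*\<^sup>* M (Bang N) \<longrightarrow> N \<in> redu A)}"

text \<open>A partial application of \<open>Mul\<close> is excluded, because one more argument makes it a redex.\<close>

fun neutral :: "'f trm \<Rightarrow> bool" where
  "neutral (Free x) = True"
| "neutral (App M N) = (M \<noteq> Mul)"
| "neutral _ = False"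

text \<open>A neutral term in function position creates no redex at the root, so only the two
  subterms can reduce.\<close>

lemma step_App_neutral:
  assumes "step (App M N) L" and "neutral M"
  obtains M' where "step M M'" "L = App M' N" | N' where "step N N'" "L = App M N'"
  using assms by (auto elim: step_AppE)

text \<open>Girard's conditions CR1, CR2 and CR3, in this order.\<close>

definition candidate :: "'f trm set \<Rightarrow> bool" where
  "candidate S \<longleftrightarrow> (\<forall>M\<in>S. SN M) \<and> (\<forall>M\<in>S. \<forall>M'. step M M' \<longrightarrow> M' \<in> S) \<and>
     (\<forall>M. neutral M \<and> (\<forall>M'. step M M' \<longrightarrow> M' \<in> S) \<longrightarrow> M \<in> S)"

lemma candidate_SN: "candidate S \<Longrightarrow> M \<in> S \<Longrightarrow> SN M"
  and candidate_step: "candidate S \<Longrightarrow> M \<in> S \<Longrightarrow> step M M' \<Longrightarrow> M' \<in> S"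
  and candidate_neutral:
    "candidate S \<Longrightarrow> neutral M \<Longrightarrow> (\<And>M'. step M M' \<Longrightarrow> M' \<in> S) \<Longrightarrow> M \<in> S"
  unfolding candidate_def by blast+

text \<open>For the positive types \<open>Q\<close> constrains only terms headed by a value
  constructor, so it is vacuous on neutral terms; any further reduct of a neutral term is reached
  through a one-step reduct, which is in the set by assumption.\<close>

lemma candidate_values:
  assumes Q: "\<And>M. neutral M \<Longrightarrow> Q M"
  shows "candidate {M. SN M \<and> (\<forall>V. step\<^sup>*\<^sup>* M V \<longrightarrow> Q V)}" (is "candidate ?S")
  unfolding candidate_def
proof (intro conjI ballI allI impI)
  show "SN M" if "M \<in> ?S" for M using that by simp
  show "M' \<in> ?S" if "M \<in> ?S" "step M M'" for M M'
  proof -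
    have "SN M'" by (rule SN_step[OF _ that(2)]) (use that in simp)
    moreover have "Q V" if "step\<^sup>*\<^sup>* M' V" for V
      using converse_rtranclp_into_rtranclp[of step, OF \<open>step M M'\<close> that] \<open>M \<in> ?S\<close> by simp
    ultimately show ?thesis by simp
  qed
  show "M \<in> ?S" if M: "neutral M \<and> (\<forall>M'. step M M' \<longrightarrow> M' \<in> ?S)" for M
  proof -
    have "SN M" by (rule SNI) (use M in simp)
    moreover have "Q V" if "step\<^sup>*\<^sup>* M V" for V
      using that
    proof (cases rule: converse_rtranclpE)
      case base
      with M Q show ?thesis by simp
    next
      case (step M')
      with M show ?thesis by simp
    qed
    ultimately show ?thesis by simp
  qed
qed

lemma candidate_SN_set: "candidate {M. SN M}"
  using candidate_values[of "\<lambda>_. True"] by simp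

lemma candidate_fun:
  assumes S: "candidate S" and T: "candidate T"
  shows "candidate {M. \<forall>N\<in>S. App M N \<in> T}" (is "candidate ?F")
  unfolding candidate_def
proof (intro conjI ballI allI impI)
  \<comment> \<open>Variables are neutral and irreducible, so CR3 applies vacuously. They supply an
    argument from which \<open>SN M\<close> can be read off.\<close>
  have var: "Free x \<in> S" for x
    by (rule candidate_neutral[OF S]) simp_all
  show "SN M" if "M \<in> ?F" for M
  proof -
    have "SN (App M (Free undefined))"
      using that var candidate_SN[OF T] by blast
    then show ?thesis
      by (rule SN_inj) (rule step.app1)
  qed
  show "M' \<in> ?F" if "M \<in> ?F" "step M M'" for M M'
    using that(1) candidate_step[OF T _ step.app1[OF that(2)]] by simp
  show "M \<in> ?F" if M: "neutral M \<and> (\<forall>M'. step M M' \<longrightarrow> M' \<in> ?F)" for M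
  proof -
    \<comment> \<open>Induction on the argument: a step in \<open>M\<close> is covered by the
      assumption on its reducts, a step in \<open>N\<close> by the induction hypothesis.\<close>
    have "App M N \<in> T" if "N \<in> S" for N
      using candidate_SN[OF S that] that
    proof (induction N rule: SN.induct)
      case (SNI N)
      show ?case
      proof (rule candidate_neutral[OF T])
        show "neutral (App M N)" using M by auto
        show "L \<in> T" if "step (App M N) L" for L
          using that conjunct1[OF M]
        proof (cases rule: step_App_neutral)
          case (1 M')
          with M SNI.prems show ?thesis by simp
        next
          case (2 N')
          with SNI candidate_step[OF S SNI.prems] show ?thesis by simp
        qed
      qed
    qed
    then show ?thesis by simp
  qed
qed

lemma candidate_redu:
  fixes A :: ty
  shows "candidate (redu A :: 'f trm set)"
proof (induction A)
  case (TLolli A B)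
  then show ?case unfolding redu.simps by (rule candidate_fun)
next
  case (TTensor A B)
  have *: "(redu (TTensor A B) :: 'f trm set) = {M. SN M \<and> (\<forall>V. step\<^sup>*\<^sup>* M V \<longrightarrow>
      (\<forall>N P. V = Tensor N P \<longrightarrow> N \<in> redu A \<and> P \<in> redu B))}"
    unfolding redu.simps by blast
  show ?case unfolding * by (rule candidate_values) auto
next
  case (TWith A B)
  have *: "(redu (TWith A B) :: 'f trm set) = {M. SN M \<and> (\<forall>V. step\<^sup>*\<^sup>* M V \<longrightarrow>
      (\<forall>N P. V = With N P \<longrightarrow> N \<in> redu A \<and> P \<in> redu B))}"
    unfolding redu.simps by blast
  show ?case unfolding * by (rule candidate_values) auto
next
  case (TBang A)
  have *: "(redu (TBang A) :: 'f trm set) = {M. SN M \<and> (\<forall>V. step\<^sup>*\<^sup>* M V \<longrightarrow>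
      (\<forall>N. V = Bang N \<longrightarrow> N \<in> redu A))}"
    unfolding redu.simps by blast
  show ?case unfolding * by (rule candidate_values) auto
qed (simp_all add: candidate_SN_set)

lemmas redu_SN = candidate_SN[OF candidate_redu]
  and redu_step = candidate_step[OF candidate_redu]
  and redu_neutral = candidate_neutral[OF candidate_redu]

section \<open>Reducibility of the term constructors\<close>

lemma redu_steps: "step\<^sup>*\<^sup>* M M' \<Longrightarrow> M \<in> redu A \<Longrightarrow> M' \<in> redu A"
  by (induction rule: rtranclp_induct) (simp, rule redu_step)

lemma redu_Free: "Free x \<in> redu A"
  by (rule redu_neutral) simp_all

text \<open>No rule contracts a \<open>Tensor\<close> at its root. Hence, in
  \<open>redu_Tensor\<close>, every reduct of a pair has reducible components.\<close>

lemma steps_Tensor: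
  "step\<^sup>*\<^sup>* (Tensor M N) L \<Longrightarrow> \<exists>M' N'. L = Tensor M' N' \<and> step\<^sup>*\<^sup>* M M' \<and> step\<^sup>*\<^sup>* N N'"
  by (induction rule: rtranclp_induct) (auto elim!: step_TensorE intro: rtranclp.rtrancl_into_rtrancl)

lemma steps_With:
  "step\<^sup>*\<^sup>* (With M N) L \<Longrightarrow> \<exists>M' N'. L = With M' N' \<and> step\<^sup>*\<^sup>* M M' \<and> step\<^sup>*\<^sup>* N N'"
  by (induction rule: rtranclp_induct) (auto elim!: step_WithE intro: rtranclp.rtrancl_into_rtrancl)

lemma steps_Bang: "step\<^sup>*\<^sup>* (Bang M) L \<Longrightarrow> \<exists>M'. L = Bang M' \<and> step\<^sup>*\<^sup>* M M'"
  by (induction rule: rtranclp_induct) (auto elim!: step_BangE intro: rtranclp.rtrancl_into_rtrancl)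

lemma redu_Tensor: "M \<in> redu A \<Longrightarrow> N \<in> redu B \<Longrightarrow> Tensor M N \<in> redu (TTensor A B)"
  by (auto intro: SN_Tensor redu_SN redu_steps dest!: steps_Tensor)

lemma redu_With: "M \<in> redu A \<Longrightarrow> N \<in> redu B \<Longrightarrow> With M N \<in> redu (TWith A B)"
  by (auto intro: SN_With redu_SN redu_steps dest!: steps_With)

lemma redu_Bang: "M \<in> redu A \<Longrightarrow> Bang M \<in> redu (TBang A)"
  by (auto intro: SN_Bang redu_SN redu_steps dest!: steps_Bang)

lemma redu_Const: "Const r \<in> redu TReal"
  by (auto intro: SNI)

lemma redu_Unit: "Unit \<in> redu TOne"
  by (auto intro: SNI)

lemma redu_Top: "Top \<in> redu TTop"
  by (auto intro: SNI)

primrec sty :: "ty pat \<Rightarrow> ty" where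
  "sty (PVar A) = A"
| "sty (PBang A) = TBang A"
| "sty PUnit = TOne"
| "sty (PTensor p q) = TTensor (sty p) (sty q)"
| "sty (PWith p q) = TWith (sty p) (sty q)"

text \<open>A matched value reduces to itself in zero steps, so the clauses of \<open>redu\<close>
  yield its components directly.\<close>

lemma matches_redu:
  "matches s V vs \<Longrightarrow> V \<in> redu (sty s) \<Longrightarrow> list_all2 (\<lambda>N A. N \<in> redu A) vs (pvars s)"
proof (induction rule: matches.induct)
  case (4 p V vs q W ws)
  then show ?case by (auto intro!: list_all2_appendI)
next
  case (5 p V vs q W ws)
  then show ?case by (auto intro!: list_all2_appendI)
qed auto

lemma redu_Lam:
  assumes M: "\<And>vs. list_all2 (\<lambda>N A. N \<in> redu A) vs (pvars s) \<Longrightarrow> sub Free (inst vs) M \<in> redu B"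
  shows "Lam s M \<in> redu (TLolli (sty s) B)"
proof -
  \<comment> \<open>Instantiating the pattern by free variables, which are reducible, and pulling
    back along substitution gives termination of the body itself.\<close>
  have "SN (sub Free (inst (map (\<lambda>_. Free undefined) (pvars s))) M)"
    by (rule redu_SN, rule M) (auto simp: list_all2_conv_all_nth redu_Free)
  then have "SN M"
    by (rule SN_inj) (rule step_sub)
  have "App (Lam s M) N \<in> redu B" if "N \<in> redu (sty s)" for N
  proof -
    have "SN N" using that by (rule redu_SN)
    from \<open>SN M\<close> this M that show ?thesis
    \<comment> \<open>The assumptions on the body and the argument travel with the induction, since
      both survive reduction. The application is neutral, so only its one-step reducts matter; a
      failed match contributes no beta step.\<close>
    proof (induction rule: SN_induct2)
      case (step M N)
      note hyps = step
      show ?case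
      proof (rule redu_neutral)
        fix L assume "step (App (Lam s M) N) L"
        then show "L \<in> redu B"
        proof cases
          case (beta vs)
          then show ?thesis using hyps(5)[OF matches_redu[OF _ hyps(6)]] by simp
        next
          case (app1 L')
          then obtain M' where M': "step M M'" "L' = Lam s M'" by (auto elim: step_LamE)
          have "sub Free (inst vs) M' \<in> redu B"
            if "list_all2 (\<lambda>N A. N \<in> redu A) vs (pvars s)" for vs
            using redu_step[OF hyps(5)[OF that] step_sub[OF M'(1)]] .
          then show ?thesis using hyps M' app1 by auto
        next
          case (app2 N')
          then show ?thesis using hyps redu_step[OF hyps(6)] by simp
        qed
      qed simp
    qed
  qed
  then show ?thesis by simp
qed

lemma redu_Fun:
  fixes f :: 'f
  shows "Fun f \<in> redu (TLolli A (TBang TReal))"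
proof -
  have "App (Fun f) N \<in> redu (TBang TReal)" if "SN N" for N :: "'f trm"
    using that
  proof (induction rule: SN.induct)
    case (SNI N)
    show ?case
    proof (rule redu_neutral)
      fix L assume "step (App (Fun f) N) L"
      then show "L \<in> redu (TBang TReal)"
        by (rule step_AppE) (use SNI redu_Bang[OF redu_Const] in auto)
    qed simp
  qed
  then show ?thesis using redu_SN by auto
qed

lemma redu_Add: "(Add :: 'f trm) \<in> redu (TLolli A TReal)"
proof -
  have "SN (App Add N)" if "SN N" for N :: "'f trm"
    using that
  proof (induction rule: SN.induct)
    case (SNI N)
    show ?case
    proof (rule SN.SNI)
      fix L assume "step (App Add N) L"
      then show "SN L"
        by (rule step_AppE) (use SNI redu_Const in auto)
    qed
  qed
  then show ?thesis using redu_SN by auto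
qed

text \<open>\<open>App Mul N\<close> is not neutral, so the clauses for \<open>TLolli\<close> are
  unfolded twice and termination of the full application is shown directly.\<close>

lemma redu_Mul: "(Mul :: 'f trm) \<in> redu (TLolli A (TLolli B TReal))"
proof -
  have "SN (App (App Mul N) P)" if "SN N" "SN P" for N P :: "'f trm"
    using that
  proof (induction rule: SN_induct2)
    case (step N P)
    show ?case
    proof (rule SNI)
      fix L assume "step (App (App Mul N) P) L"
      then show "SN L"
        by (rule step_AppE) (use step redu_Const in \<open>auto elim: step_AppE\<close>)
    qed
  qed
  then show ?thesis using redu_SN by auto
qed

section \<open>Typing without environments\<close>

text \<open>\<open>E\<close> lists the types of the bound variables of the enclosing binders, innermost first.\<close>

inductive wt :: "('f \<Rightarrow> nat) \<Rightarrow> ty list list \<Rightarrow> 'f trm \<Rightarrow> ty \<Rightarrow> bool" for ar where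
  "wt ar E (Free x) (vty x)"
| "k < length E \<Longrightarrow> i < length (E ! k) \<Longrightarrow> wt ar E (Bound k i) (E ! k ! i)"
| "wt ar E M A \<Longrightarrow> wt ar E (Bang M) (TBang A)"
| "wt ar (pvars s # E) M B \<Longrightarrow> wt ar E (Lam s M) (TLolli (sty s) B)"
| "wt ar E M (TLolli A B) \<Longrightarrow> wt ar E N A \<Longrightarrow> wt ar E (App M N) B"
| "wt ar E Unit TOne"
| "wt ar E M A \<Longrightarrow> wt ar E N B \<Longrightarrow> wt ar E (Tensor M N) (TTensor A B)"
| "wt ar E Top TTop"
| "wt ar E M A \<Longrightarrow> wt ar E N B \<Longrightarrow> wt ar E (With M N) (TWith A B)"
| "wt ar E (Const r) TReal"
| "wt ar E (Fun f) (TLolli (tensor_ty (replicate (ar f) (TBang TReal))) (TBang TReal))"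
| "wt ar E Add (TLolli (TWith TReal TReal) TReal)"
| "wt ar E Mul (TLolli TReal (TLolli TReal TReal))"

text \<open>Fundamental lemma. Free variables stay fixed, being reducible at every type; only bound
  variables receive reducible images.\<close>

lemma wt_redu:
  assumes "wt ar E M A"
    and "\<And>k i. k < length E \<Longrightarrow> i < length (E ! k) \<Longrightarrow> \<sigma> k i \<in> redu (E ! k ! i)"
  shows "sub Free \<sigma> M \<in> redu A"
  using assms
proof (induction arbitrary: \<sigma> rule: wt.induct)
  case (1 E x)
  show ?case unfolding sub.simps by (rule redu_Free)
next
  case (2 k E i)
  then show ?case by simp
next
  case (3 E M A)
  show ?case unfolding sub.simps by (intro redu_Bang "3.IH" "3.prems")
next
  case (4 s E M B)
  have "sub Free (inst vs) (sub Free (ups \<sigma>) M) \<in> redu B"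
    if vs: "list_all2 (\<lambda>N A. N \<in> redu A) vs (pvars s)" for vs
  proof -
    \<comment> \<open>\<open>vs\<close> fills the new innermost level and \<open>\<sigma>\<close>
      the outer ones, matching \<open>pvars s # E\<close>.\<close>
    have "sub Free (case_nat (inst vs 0) \<sigma>) M \<in> redu B"
      by (rule "4.IH") (use vs "4.prems" in \<open>auto simp: list_all2_conv_all_nth less_Suc_eq_0_disj\<close>)
    then show ?thesis using sub_inst_ups[of vs Free \<sigma> M] by simp
  qed
  then show ?case unfolding sub.simps ren.simps by (rule redu_Lam)
next
  case (5 E M A B N)
  have "sub Free \<sigma> M \<in> redu (TLolli A B)" "sub Free \<sigma> N \<in> redu A"
    using "5.IH" "5.prems" by blast+
  then show ?case by simp
next
  case (7 E M A N B)
  show ?case unfolding sub.simps by (intro redu_Tensor "7.IH" "7.prems")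
next
  case (9 E M A N B)
  show ?case unfolding sub.simps by (intro redu_With "9.IH" "9.prems")
qed (simp_all only: sub.simps redu_Unit redu_Top redu_Const redu_Fun redu_Add redu_Mul)

lemma map_of_zip_upt_SomeD:
  "map_of (zip xs [0..<length xs]) x = Some i \<Longrightarrow> i < length xs \<and> xs ! i = x"
  by (auto dest!: map_of_SomeD simp: in_set_zip)

text \<open>The captured variables form the outermost level, which stays at the end of the list
  while binders inside \<open>M\<close> extend the front. Their types are known because variables
  carry them.\<close>

lemma wt_close:
  "wt ar E M A \<Longrightarrow> wt ar (E @ [map vty xs]) (close (length E) xs M) A"
proof (induction rule: wt.induct)
  case (1 E x)
  show ?case
  proof (cases "map_of (zip xs [0..<length xs]) x")
    case None
    show ?thesis unfolding close.simps None by (simp add: wt.intros)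
  next
    case (Some i)
    then have "i < length xs" "xs ! i = x" by (auto dest: map_of_zip_upt_SomeD)
    then show ?thesis
      using wt.intros(2)[of "length E" "E @ [map vty xs]" i ar] Some by simp
  qed
next
  case (2 k E i)
  then show ?case using wt.intros(2)[of k "E @ [map vty xs]" i ar] by (simp add: nth_append)
qed (auto intro: wt.intros)

lemma sty_map_pat [simp]: "sty (map_pat vty p) = pty p"
  by (induction p) simp_all

lemma pvars_map_pat [simp]: "pvars (map_pat f p) = map f (pvars p)"
  by (induction p) simp_all

text \<open>Weakening and the pattern rules change neither term nor type, so they disappear; only
  abstraction needs work.\<close>

lemma typing_wt: "typing ar \<Gamma> M A \<Longrightarrow> wt ar [] M A"
proof (induction rule: typing.induct)
  case (lam p \<Delta> M B)
  then have "wt ar [pvars (map_pat vty p)] (close 0 (pvars p) M) B"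
    using wt_close[of ar "[]"] by simp
  then show ?case using wt.intros(4) unfolding lam_def by fastforce
qed (auto intro: wt.intros)

section \<open>Embedding the reduction\<close>

text \<open>Local closure at depth \<open>n\<close>. At depth 0 it makes a term invariant under
  \<open>lift\<close>, as the unshifted named substitution requires.\<close>

primrec lcat :: "nat \<Rightarrow> 'f trm \<Rightarrow> bool" where
  "lcat n (Free x) = True"
| "lcat n (Bound k i) = (k < n)"
| "lcat n (Bang M) = lcat n M"
| "lcat n (Lam s M) = lcat (Suc n) M"
| "lcat n (App M N) = (lcat n M \<and> lcat n N)"
| "lcat n Unit = True"
| "lcat n (Tensor M N) = (lcat n M \<and> lcat n N)"
| "lcat n Top = True"
| "lcat n (With M N) = (lcat n M \<and> lcat n N)"
| "lcat n (Const c) = True"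
| "lcat n (Fun f) = True"
| "lcat n Add = True"
| "lcat n Mul = True"

lemma lcat_close: "lcat n M \<Longrightarrow> lcat (Suc n) (close n xs M)"
  by (induction M arbitrary: n) (auto split: option.split)

lemma is_term_lcat: "is_term M \<Longrightarrow> lcat 0 M"
  by (induction rule: is_term.induct) (auto simp: lam_def lcat_close)

lemma sub_cong:
  "lcat n M \<Longrightarrow> (\<And>k i. k < n \<Longrightarrow> \<sigma> k i = \<sigma>' k i) \<Longrightarrow> (\<And>x. x \<in> fv M \<Longrightarrow> \<phi> x = \<phi>' x)
     \<Longrightarrow> sub \<phi> \<sigma> M = sub \<phi>' \<sigma>' M"
proof (induction M arbitrary: n \<phi> \<phi>' \<sigma> \<sigma>')
  case (Bang M)
  from Bang.prems show ?case using Bang.IH[of n \<sigma> \<sigma>' \<phi> \<phi>'] by simp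
next
  case (Lam s M)
  have "ups \<sigma> k i = ups \<sigma>' k i" if "k < Suc n" for k i
    using that Lam.prems(2) by (cases k) simp_all
  then show ?case
    using Lam.prems Lam.IH[of "Suc n" "ups \<sigma>" "ups \<sigma>'" "\<lambda>x. lift (\<phi> x)" "\<lambda>x. lift (\<phi>' x)"] by simp
next
  case (App M N)
  from App.prems show ?case
    using App.IH(1)[of n \<sigma> \<sigma>' \<phi> \<phi>'] App.IH(2)[of n \<sigma> \<sigma>' \<phi> \<phi>'] by simp
next
  case (Tensor M N)
  from Tensor.prems show ?case
    using Tensor.IH(1)[of n \<sigma> \<sigma>' \<phi> \<phi>'] Tensor.IH(2)[of n \<sigma> \<sigma>' \<phi> \<phi>'] by simp
next
  case (With M N)
  from With.prems show ?case
    using With.IH(1)[of n \<sigma> \<sigma>' \<phi> \<phi>'] With.IH(2)[of n \<sigma> \<sigma>' \<phi> \<phi>'] by simp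
qed simp_all

lemma lift_lcat:
  assumes "lcat 0 M"
  shows "lift M = M"
proof -
  have "lift M = sub Free Bound (lift M)" by simp
  also have "\<dots> = sub Free (\<lambda>k. Bound (Suc k)) M" by (rule sub_ren)
  also have "\<dots> = sub Free Bound M" by (rule sub_cong[OF assms]) auto
  finally show ?thesis by simp
qed

section \<open>Named operations as simultaneous substitutions\<close>

lemma close_eq_sub:
  fixes M :: "'f trm"
  shows "close k xs M =
     sub (\<lambda>x. case map_of (zip xs [0..<length xs]) x of None \<Rightarrow> Free x | Some i \<Rightarrow> Bound k i) Bound M"
proof (induction M arbitrary: k)
  case (Lam s M)
  \<comment> \<open>Lifting the images raises level \<open>k\<close> to \<open>Suc k\<close>, the
    level at which \<open>close\<close> continues under the binder.\<close>
  have "(\<lambda>x. lift (case map_of (zip xs [0..<length xs]) x of None \<Rightarrow> Free x | Some i \<Rightarrow> Bound k i))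
      = (\<lambda>x. case map_of (zip xs [0..<length xs]) x of None \<Rightarrow> Free x :: 'f trm | Some i \<Rightarrow> Bound (Suc k) i)"
    by (simp add: option.case_distrib[of lift] cong: option.case_cong)
  with Lam show ?case by simp
qed simp_all

lemma subst_eq_sub: "lcat 0 N \<Longrightarrow> subst x N M = sub (Free(x := N)) Bound M"
proof (induction M)
  case (Lam s M)
  have "(\<lambda>y. lift ((Free(x := N)) y)) = Free(x := N)"
    using Lam.prems by (auto simp: fun_eq_iff lift_lcat)
  with Lam show ?case by (simp del: fun_upd_apply)
qed auto

definition assign :: "(var \<times> 'f trm) list \<Rightarrow> var \<Rightarrow> 'f trm" where
  "assign ps x = (case map_of ps x of None \<Rightarrow> Free x | Some N \<Rightarrow> N)"

lemma assign_Nil: "assign [] = Free"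
  by (auto simp: assign_def fun_eq_iff)

lemma assign_single: "assign [(x, N)] = Free(x := N)"
  by (auto simp: assign_def fun_eq_iff)

lemma matches_map_pat: "matches p V vs \<Longrightarrow> matches (map_pat f p) V vs"
  by (induction rule: matches.induct) (auto intro: matches.intros)

lemma is_value_matches: "is_value ar p V \<Longrightarrow> \<exists>vs. matches p V vs"
  by (induction rule: is_value.induct) (blast intro: matches.intros)+

lemma matches_length: "matches p V vs \<Longrightarrow> length vs = length (pvars p)"
  by (induction rule: matches.induct) simp_all

lemma matches_components:
  "matches p V vs \<Longrightarrow> N \<in> set vs \<Longrightarrow> fv N \<subseteq> fv V \<and> (lcat 0 V \<longrightarrow> lcat 0 N)"
  by (induction rule: matches.induct) auto

text \<open>Sequential substitution is parallel when the first images avoid the later variables: the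
  second pass then fixes those images. \<open>map_of\<close> on the joined list gives priority to
  \<open>xs\<close>, just as substituting for \<open>xs\<close> first does.\<close>

lemma assign_append:
  assumes "length xs = length vs"
    and vs: "\<And>N. N \<in> set vs \<Longrightarrow> lcat 0 N \<and> fv N \<inter> set ys = {}"
  shows "sub (assign (zip ys ws)) Bound (sub (assign (zip xs vs)) Bound M)
    = sub (assign (zip (xs @ ys) (vs @ ws))) Bound M"
proof -
  have "sub (assign (zip ys ws)) Bound N = N" if "N \<in> set vs" for N
  proof -
    have "assign (zip ys ws) y = Free y" if "y \<in> fv N" for y
    proof -
      have "map_of (zip ys ws) y = None"
        unfolding map_of_eq_None_iff
        using that vs[OF \<open>N \<in> set vs\<close>] by (force dest: set_zip_leftD)
      then show ?thesis unfolding assign_def by (simp only: option.case)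
    qed
    then have "sub (assign (zip ys ws)) Bound N = sub Free Bound N"
      using vs[OF that] by (intro sub_cong[of 0]) auto
    then show ?thesis by simp
  qed
  note vs_fixed = this
  have "sub (assign (zip ys ws)) Bound (assign (zip xs vs) x) = assign (zip (xs @ ys) (vs @ ws)) x"
    for x
  proof -
    have *: "map_of (zip (xs @ ys) (vs @ ws)) x
      = (case map_of (zip xs vs) x of None \<Rightarrow> map_of (zip ys ws) x | Some N \<Rightarrow> Some N)"
      by (simp add: assms(1) map_add_def)
    show ?thesis
    proof (cases "map_of (zip xs vs) x")
      case None
      show ?thesis by (simp only: assign_def * None option.case sub.simps)
    next
      case (Some N)
      then have "N \<in> set vs" by (rule set_zip_rightD[OF map_of_SomeD])
      then show ?thesis by (simp only: assign_def[of _ x] * Some option.case vs_fixed)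
    qed
  qed
  then show ?thesis by (simp add: sub_sub)
qed

text \<open>Common core of the two pair cases of \<open>psubst_eq_sub\<close>, with the induction
  hypotheses as premises. Freshness passes from a value to its matched components.\<close>

lemma psubst_append:
  assumes IH1: "\<And>M. wf_pat p \<Longrightarrow> lcat 0 V \<Longrightarrow> set (pvars p) \<inter> fv V = {}
      \<Longrightarrow> psubst p V M = sub (assign (zip (pvars p) vs)) Bound M"
    and IH2: "\<And>M. wf_pat q \<Longrightarrow> lcat 0 W \<Longrightarrow> set (pvars q) \<inter> fv W = {}
      \<Longrightarrow> psubst q W M = sub (assign (zip (pvars q) ws)) Bound M"
    and "matches p V vs" and "distinct (pvars p @ pvars q)" and "lcat 0 V" and "lcat 0 W"
    and "set (pvars p @ pvars q) \<inter> (fv V \<union> fv W) = {}"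
  shows "psubst q W (psubst p V M) = sub (assign (zip (pvars p @ pvars q) (vs @ ws))) Bound M"
proof -
  have "lcat 0 N \<and> fv N \<inter> set (pvars q) = {}" if "N \<in> set vs" for N
    using matches_components[OF assms(3) that] assms by auto
  moreover have "psubst p V M = sub (assign (zip (pvars p) vs)) Bound M"
    by (rule IH1) (use assms in \<open>auto simp: wf_pat_def\<close>)
  moreover have "psubst q W L = sub (assign (zip (pvars q) ws)) Bound L" for L
    by (rule IH2) (use assms in \<open>auto simp: wf_pat_def\<close>)
  ultimately show ?thesis
    using assign_append matches_length[OF assms(3)] by metis
qed

lemma psubst_eq_sub:
  "matches p V vs \<Longrightarrow> wf_pat p \<Longrightarrow> lcat 0 V \<Longrightarrow> set (pvars p) \<inter> fv V = {}
     \<Longrightarrow> psubst p V M = sub (assign (zip (pvars p) vs)) Bound M"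
proof (induction arbitrary: M rule: matches.induct)
  case (1 x V)
  then show ?case by (simp add: subst_eq_sub assign_single del: fun_upd_apply)
next
  case (2 x N)
  then show ?case by (simp add: subst_eq_sub assign_single del: fun_upd_apply)
next
  case 3
  show ?case by (simp add: assign_Nil)
next
  case (4 p V vs q W ws)
  have "psubst q W (psubst p V M) = sub (assign (zip (pvars p @ pvars q) (vs @ ws))) Bound M"
    by (rule psubst_append) (use 4 in \<open>auto simp: wf_pat_def\<close>)
  then show ?case by simp
next
  case (5 p V vs q W ws)
  have "psubst q W (psubst p V M) = sub (assign (zip (pvars p @ pvars q) (vs @ ws))) Bound M"
    by (rule psubst_append) (use 5 in \<open>auto simp: wf_pat_def\<close>)
  then show ?case by simp
qed

lemma inst_close:
  assumes "lcat 0 M" and len: "length vs = length xs"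
  shows "sub Free (inst vs) (close 0 xs M) = sub (assign (zip xs vs)) Bound M"
proof -
  \<comment> \<open>Factors the assignment through positions: \<open>close\<close> sends a variable
    to its index, \<open>inst\<close> sends the index to the entry of \<open>vs\<close>.\<close>
  have "zip xs vs = map (\<lambda>(x, i). (x, vs ! i)) (zip xs [0..<length xs])"
    by (rule nth_equalityI) (simp_all add: len)
  then have "map_of (zip xs vs) x = map_option ((!) vs) (map_of (zip xs [0..<length xs]) x)" for x
    by (simp add: map_of_map)
  then have *: "sub Free (inst vs)
      (case map_of (zip xs [0..<length xs]) x of None \<Rightarrow> Free x | Some i \<Rightarrow> Bound 0 i)
    = assign (zip xs vs) x" for x
    by (auto simp: assign_def len dest: map_of_zip_upt_SomeD split: option.split)
  show ?thesis
    unfolding close_eq_sub sub_sub by (rule sub_cong[OF assms(1)]) (simp, rule *)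
qed

lemma red_step: "red ar den M M' \<Longrightarrow> step M M'"
proof (induction rule: red.induct)
  case (beta p M V)
  then obtain vs where vs: "matches p V vs" using is_value_matches by blast
  have "step (App (lam p M) V) (sub Free (inst vs) (close 0 (pvars p) M))"
    unfolding lam_def by (intro step.beta matches_map_pat vs)
  \<comment> \<open>Both contracta are the parallel substitution of \<open>vs\<close> for the
    variables of \<open>p\<close>.\<close>
  also have "sub Free (inst vs) (close 0 (pvars p) M) = psubst p V M"
    using beta by (simp add: inst_close is_term_lcat matches_length[OF vs] psubst_eq_sub[OF vs])
  finally show ?case .
next
  case (lam p M M')
  \<comment> \<open>Closing is a substitution, hence preserves steps.\<close>
  then show ?case
    by (simp add: lam_def close_eq_sub step.lam step_sub)
qed (simp_all add: step.intros)

theorem theorem3p2: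
  fixes ar :: "'f \<Rightarrow> nat" and den :: "'f \<Rightarrow> real list \<Rightarrow> real" and M :: "'f trm"
  assumes "\<And>f. 1 \<le> ar f"
    and "\<And>f. differentiable_Rn (ar f) (den f)"
    and "well_typed ar M"
  shows "strongly_normalizing ar den M"
proof -
  from assms(3) obtain A where "wt ar [] M A"
    unfolding well_typed_def using typing_wt by blast
  then have "sub Free Bound M \<in> redu A"
    by (rule wt_redu) simp
  then have "SN M"
    by (simp add: redu_SN)
  then have "\<exists>i. \<not> red ar den (S i) (S (Suc i))" if "S 0 = M" for S
    using that
  proof (induction M arbitrary: S rule: SN.induct)
    case (SNI M)
    show ?case
    proof (cases "red ar den M (S 1)")
      case True
      \<comment> \<open>The induction hypothesis is applied to the tail of the sequence, which
        starts at the reduct \<open>S 1\<close>.\<close>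
      have "\<exists>i. \<not> red ar den (S (Suc i)) (S (Suc (Suc i)))"
        by (rule SNI.IH[OF red_step[OF True]]) simp
      then show ?thesis by blast
    next
      case False
      with SNI.prems show ?thesis by (metis One_nat_def)
    qed
  qed
  then show ?thesis
    unfolding strongly_normalizing_def by blast
qed

end
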